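(* Let $\widehat\theta$ be an estimator in the class $\mathcal{A}$ and let $\theta_\infty$ be any fixed parameter sequence with first $n$ coordinates $\theta_n\in\mathbb{R}^n$. Then $$\Big|\,\rho_0(\theta_n,\widehat\theta_n)-\frac n2\log\big(1+(nr)^{-1}q(\theta_n,\widehat\theta_n)\big)\Big|\le O(1)\quad\text{as } n\to\infty .$$ Moreover, if $\widehat c(X_n)=1+(nr)^{-1}\widehat U_n$, where $\widehat U_n=\widehat U_n(X_n)$ is a suitable estimate of the quadratic risk of $\widehat\theta_n$, then $$\rho\big(\theta_n,g[\widehat\theta_n,\widehat c(X_n)]\big)-\rho_0(\theta_n,\widehat\theta_n)\le O(1)\quad\text{as } n\to\infty .$$
   Context: Fix $r\in(0,\infty)$. For each $n$, the observed past is $X_n\sim N(\theta_n,I_n)$ and the unobserved future is $Y_n\sim N(\theta_n,rI_n)$, independent of $X_n$ (so the past variance is $\sigma_p^2=1$ and the future variance is $\sigma_f^2=r$). Here $\theta_\infty$ is a fixed real sequence and $\theta_n$ is the vector of its first $n$ values. Write $\mathbb{E}_{\theta_n}$, $\mathrm{Var}_{\theta_n}$ for expectation and variance when $X_n\sim N(\theta_n,I_n)$. A predictive density estimate $\widehat p(\cdot|X_n)$ has Kullback-Leibler predictive risk $\rho(\theta_n,\widehat p)=\mathbb{E}_{\theta_n}\int p_{\theta_n}(y)\log\frac{p_{\theta_n}(y)}{\widehat p(y|X_n)}\,dy$, where $p_{\theta_n}$ is the $N(\theta_n,rI_n)$ density. For $\mu\in\mathbb{R}^n$ and $c>0$, $g[\mu,c]$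 is the density of $N(\mu,c\,r\,I_n)$. A location estimate is $\widehat\theta_n=\widehat\theta_n(X_n)\in\mathbb{R}^n$; its quadratic risk is $q(\theta_n,\widehat\theta_n)=\mathbb{E}_{\theta_n}\|\widehat\theta_n(X_n)-\theta_n\|^2$, and $$\rho_0(\theta_n,\widehat\theta_n)=\inf_{\widehat c(X_n)>0}\rho(\theta_n,g[\widehat\theta_n,\widehat c(X_n)]),$$ the infimum being over all positive scale estimates based on $X_n$. An estimator $\widehat\theta$ (a family $(\widehat\theta_n)_{n\ge1}$) belongs to $\mathcal{A}$ if for any fixed parameter sequence, as $n\to\infty$: (i) $q(\theta_n,\widehat\theta_n)\le O(n)$; (ii) $\mathrm{Var}_{\theta_n}(\|\widehat\theta_n-\theta_n\|^2)\le O(n)$; and (iii) there exists a suitable estimate of its quadratic risk, i.e. a statistic $\widehat U_n=\widehat U_n(X_n)$ such that $|\mathbb{E}_{\theta_n}(\widehat U_n)-q(\theta_n,\widehat\theta_n)|\le O(n^{1/2})$, $\mathrm{Var}_{\theta_n}(\widehat U_n)\le O(n)$, and $\mathrm{Var}_{\theta_n}\{(1+(nr)^{-1}\widehat U_n)^{-1}\}\le O(n^{-1})$. It is understood that $1+(nr)^{-1}\widehat U_n>0$ almost surely. Constants in $O(\cdot)$ may depend on $r$ and on the parameter sequence but not on $n$. *)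

theory Defs
  imports "HOL-Probability.Probability"
begin

text \<open>
  The dimension \<open>n\<close> varies within a statement, so a vector of \<open>\<real>\<^sup>n\<close> is a function
  \<open>nat \<Rightarrow> real\<close> of which only the coordinates \<open>i < n\<close> are used. In particular a real
  sequence \<open>\<theta>\<close>, used together with \<open>n\<close>, stands for the vector of its first \<open>n\<close> values.
\<close>

type_synonym vec = "nat \<Rightarrow> real"

definition leb :: "nat \<Rightarrow> vec measure" where
  "leb n = (\<Pi>\<^sub>M i\<in>{..<n}. lborel)"

definition sqdist :: "nat \<Rightarrow> vec \<Rightarrow> vec \<Rightarrow> real" where
  "sqdist n a b = (\<Sum>i<n. (a i - b i)\<^sup>2)"

text \<open>Density and law of \<open>N(\<mu>, v I)\<close> on \<open>\<real>\<^sup>n\<close>; the parameter \<open>v\<close> is the variance, whereas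
  \<^const>\<open>normal_density\<close> takes the standard deviation.\<close>

definition gauss_density :: "nat \<Rightarrow> vec \<Rightarrow> real \<Rightarrow> vec \<Rightarrow> real" where
  "gauss_density n \<mu> v y = (\<Prod>i<n. normal_density (\<mu> i) (sqrt v) (y i))"

definition gauss :: "nat \<Rightarrow> vec \<Rightarrow> real \<Rightarrow> vec measure" where
  "gauss n \<mu> v = density (leb n) (\<lambda>y. ennreal (gauss_density n \<mu> v y))"

text \<open>Risks may be infinite, and the Bochner integral of a non-integrable function is 0, which
  would corrupt an infimum of risks. Hence the extended integral, with the convention that
  \<open>\<infinity> - \<infinity> = \<infinity>\<close>. That case does not arise in the Kullback-Leibler risk below, as the integrand
  \<open>p log (p / q)\<close> has an integrable negative part for all densities \<open>p\<close>, \<open>q\<close>.\<close>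

definition ext_integral :: "'a measure \<Rightarrow> ('a \<Rightarrow> ereal) \<Rightarrow> ereal" where
  "ext_integral M f =
     enn2ereal (\<integral>\<^sup>+x. e2ennreal (f x) \<partial>M) - enn2ereal (\<integral>\<^sup>+x. e2ennreal (- f x) \<partial>M)"

text \<open>On a probability space this is \<open>\<infinity>\<close> for every measurable \<open>f\<close> that is not square integrable,
  so a finite bound on it entails that the mean of \<open>f\<close> exists.\<close>

definition ext_variance :: "'a measure \<Rightarrow> ('a \<Rightarrow> real) \<Rightarrow> ennreal" where
  "ext_variance M f = (\<integral>\<^sup>+x. ennreal ((f x - (\<integral>z. f z \<partial>M))\<^sup>2) \<partial>M)"

text \<open>The value \<open>phat x y\<close> is the predictive density estimate at \<open>y\<close> given the observed past \<open>x\<close>.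
  The true density is positive, so the integrand is \<open>\<infinity>\<close> where the estimate vanishes
  (in HOL, \<open>ln (p / 0) = 0\<close>).\<close>

definition pred_risk :: "nat \<Rightarrow> real \<Rightarrow> vec \<Rightarrow> (vec \<Rightarrow> vec \<Rightarrow> real) \<Rightarrow> ereal" where
  "pred_risk n r \<theta> phat =
     ext_integral (gauss n \<theta> 1) (\<lambda>x. ext_integral (leb n) (\<lambda>y.
       if phat x y = 0 then \<infinity>
       else ereal (gauss_density n \<theta> r y * ln (gauss_density n \<theta> r y / phat x y))))"

definition quad_risk :: "nat \<Rightarrow> vec \<Rightarrow> (vec \<Rightarrow> vec) \<Rightarrow> ennreal" where
  "quad_risk n \<theta> t = (\<integral>\<^sup>+x. ennreal (sqdist n (t x) \<theta>) \<partial>gauss n \<theta> 1)"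

text \<open>The predictive density estimate \<open>g[t(x), c(x)]\<close>, where \<open>g[\<mu>, c]\<close> is the density of
  \<open>N(\<mu>, c r I)\<close>.\<close>

definition gauss_pde :: "nat \<Rightarrow> real \<Rightarrow> (vec \<Rightarrow> vec) \<Rightarrow> (vec \<Rightarrow> real) \<Rightarrow> vec \<Rightarrow> vec \<Rightarrow> real" where
  "gauss_pde n r t c x = gauss_density n (t x) (c x * r)"

definition scale_estimates :: "nat \<Rightarrow> vec \<Rightarrow> (vec \<Rightarrow> real) set" where
  "scale_estimates n \<theta> = {c \<in> borel_measurable (leb n). AE x in gauss n \<theta> 1. c x > 0}"

definition rho0 :: "nat \<Rightarrow> real \<Rightarrow> vec \<Rightarrow> (vec \<Rightarrow> vec) \<Rightarrow> ereal" where
  "rho0 n r \<theta> t = (INF c\<in>scale_estimates n \<theta>. pred_risk n r \<theta> (gauss_pde n r t c))"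

definition plugin_scale :: "nat \<Rightarrow> real \<Rightarrow> (vec \<Rightarrow> real) \<Rightarrow> vec \<Rightarrow> real" where
  "plugin_scale n r u x = 1 + u x / (real n * r)"

text \<open>A statistic is a function of the data alone: the same \<open>U\<close> serves every parameter
  sequence \<open>\<theta>\<close>, while the constants may depend on \<open>\<theta>\<close>. In the bound on the bias, \<open>enn2real\<close>
  matters only where the quadratic risk is finite, which holds for large \<open>n\<close> in the class below.\<close>

definition suitable_risk_estimate ::
  "real \<Rightarrow> (nat \<Rightarrow> vec \<Rightarrow> vec) \<Rightarrow> (nat \<Rightarrow> vec \<Rightarrow> real) \<Rightarrow> bool" where
  "suitable_risk_estimate r t U \<longleftrightarrow>
     (\<forall>n\<ge>1. U n \<in> borel_measurable (leb n)) \<and>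
     (\<forall>\<theta>.
       (\<forall>n\<ge>1. AE x in gauss n \<theta> 1. plugin_scale n r (U n) x > 0) \<and>
       (\<exists>C. \<forall>\<^sub>F n in sequentially.
          \<bar>(\<integral>x. U n x \<partial>gauss n \<theta> 1) - enn2real (quad_risk n \<theta> (t n))\<bar> \<le> C * sqrt (real n)) \<and>
       (\<exists>C. \<forall>\<^sub>F n in sequentially.
          ext_variance (gauss n \<theta> 1) (U n) \<le> ennreal (C * real n)) \<and>
       (\<exists>C. \<forall>\<^sub>F n in sequentially.
          ext_variance (gauss n \<theta> 1) (\<lambda>x. inverse (plugin_scale n r (U n) x)) \<le> ennreal (C / real n)))"

definition class_A :: "real \<Rightarrow> (nat \<Rightarrow> vec \<Rightarrow> vec) set" where
  "class_A r = {t.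
     (\<forall>n\<ge>1. t n \<in> leb n \<rightarrow>\<^sub>M leb n) \<and>
     (\<forall>\<theta>.
       (\<exists>C. \<forall>\<^sub>F n in sequentially. quad_risk n \<theta> (t n) \<le> ennreal (C * real n)) \<and>
       (\<exists>C. \<forall>\<^sub>F n in sequentially.
          ext_variance (gauss n \<theta> 1) (\<lambda>x. sqdist n (t n x) \<theta>) \<le> ennreal (C * real n))) \<and>
     (\<exists>U. suitable_risk_estimate r t U)}"

end

theory Submission
  imports Defs
begin

text \<open>
  Put \<open>A = 1 + sqdist n (t x) \<theta> / (n r)\<close>. Given \<open>x\<close>, the divergence of \<open>g[t(x), c]\<close> from the
  true density is \<open>(n / 2) (ln c + A / c - 1)\<close>, which is least at \<open>c = A\<close>; hence the risk
  \<open>\<rho>\<^sub>0\<close> is \<open>(n / 2) E (ln A)\<close>. Jensen's inequality gives \<open>E (ln A) \<le> ln (E A)\<close>, and a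
  second-order bound gives \<open>E (ln A) \<ge> ln (E A) - Var A\<close>, where \<open>Var A = O(1 / n)\<close>. For the
  plug-in scale \<open>c\<close>, the mean of \<open>ln c + A / c - 1 - ln A\<close> is compared with the same expression
  in the means; the corrections are variances and covariances of \<open>A\<close>, \<open>c\<close> and \<open>1 / c\<close>, which
  are \<open>O(1 / n)\<close>, and the bias contributes its square.
\<close>

section \<open>Moments and logarithms\<close>

text \<open>A finite second moment about any constant forces integrability on a probability space.
  So the Bochner mean inside \<open>ext_variance\<close> is a genuine mean, not the default value 0,
  and the extended bound passes to the real variance.\<close>

lemma square_integrable_of_ext_variance:
  assumes "prob_space M" and [measurable]: "f \<in> borel_measurable M"
    and v: "ext_variance M f \<le> ennreal v" and "v \<ge> 0"
  shows "integrable M f" "integrable M (\<lambda>x. (f x - (\<integral>z. f z \<partial>M))\<^sup>2)"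
    "(\<integral>x. (f x - (\<integral>z. f z \<partial>M))\<^sup>2 \<partial>M) \<le> v"
proof -
  interpret prob_space M by fact
  define m where "m = (\<integral>z. f z \<partial>M)"
  have nn: "(\<integral>\<^sup>+x. ennreal ((f x - m)\<^sup>2) \<partial>M) \<le> ennreal v"
    using v by (simp add: ext_variance_def m_def)
  have i2: "integrable M (\<lambda>x. (f x - m)\<^sup>2)"
    by (rule integrableI_bounded) (use nn in \<open>auto intro: le_less_trans\<close>)
  have "integrable M (\<lambda>x. f x - m)"
    by (rule square_integrable_imp_integrable[OF _ i2]) measurable
  from Bochner_Integration.integrable_add[OF this, of "\<lambda>_. m"] show "integrable M f"
    by simp
  show "integrable M (\<lambda>x. (f x - (\<integral>z. f z \<partial>M))\<^sup>2)"
    using i2 by (simp add: m_def)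
  have "ennreal (\<integral>x. (f x - m)\<^sup>2 \<partial>M) \<le> ennreal v"
    using nn nn_integral_eq_integral[OF i2] by simp
  then show "(\<integral>x. (f x - (\<integral>z. f z \<partial>M))\<^sup>2 \<partial>M) \<le> v"
    using \<open>v \<ge> 0\<close> by (simp add: m_def)
qed

context prob_space
begin

text \<open>The product of the deviations is at most half the sum of their squares, so a bound
  \<open>v\<close> shared by both variances also bounds the covariance.\<close>

lemma covariance_bound:
  fixes f g :: "'a \<Rightarrow> real"
  assumes f: "integrable M f" "integrable M (\<lambda>x. (f x - expectation f)\<^sup>2)" "variance f \<le> v"
    and g: "integrable M g" "integrable M (\<lambda>x. (g x - expectation g)\<^sup>2)" "variance g \<le> v"
  shows "integrable M (\<lambda>x. f x * g x)"
    "\<bar>expectation (\<lambda>x. f x * g x) - expectation f * expectation g\<bar> \<le> v"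
proof -
  have [measurable]: "f \<in> borel_measurable M" "g \<in> borel_measurable M" using f g by auto
  define a b where "a = expectation f" and "b = expectation g"
  define s where "s x = ((f x - a)\<^sup>2 + (g x - b)\<^sup>2) / 2" for x
  have s: "integrable M s" "expectation s \<le> v"
    using f g by (auto simp: s_def[abs_def] a_def b_def)
  have bd: "\<bar>(f x - a) * (g x - b)\<bar> \<le> s x" for x
    using sum_squares_bound[of "\<bar>f x - a\<bar>" "\<bar>g x - b\<bar>"] by (simp add: s_def abs_mult)
  have p: "integrable M (\<lambda>x. (f x - a) * (g x - b))"
    by (rule Bochner_Integration.integrable_bound[OF s(1)]) (use bd in \<open>auto intro!: AE_I2 order_trans[OF bd]\<close>)
  \<comment> \<open>Only the product of the deviations is not already known to be integrable; the
    remaining terms are affine in \<open>f\<close> and \<open>g\<close> and have mean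
    \<open>a * b\<close>.\<close>
  have eq: "f x * g x = (f x - a) * (g x - b) + (a * g x + b * f x - a * b)" for x
    by (simp add: algebra_simps)
  show "integrable M (\<lambda>x. f x * g x)"
    unfolding eq using p f(1) g(1) by auto
  have "expectation (\<lambda>x. f x * g x) = expectation (\<lambda>x. (f x - a) * (g x - b)) + a * b"
    unfolding eq using p f(1) g(1) by (simp add: a_def b_def prob_space)
  moreover have "\<bar>expectation (\<lambda>x. (f x - a) * (g x - b))\<bar> \<le> expectation s"
    by (rule order_trans[OF integral_abs_bound]) (use bd p s in \<open>auto intro!: integral_mono\<close>)
  ultimately show "\<bar>expectation (\<lambda>x. f x * g x) - expectation f * expectation g\<bar> \<le> v"
    using s by (simp add: a_def b_def)
qed

text \<open>With \<open>k = n r\<close> this passes from the loss to \<open>A\<close> and from the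
  risk estimate to the plug-in scale, turning variances of order \<open>n\<close> into order
  \<open>1 / n\<close>.\<close>

lemma affine_moments:
  fixes f g :: "'a \<Rightarrow> real"
  assumes f: "integrable M f" "integrable M (\<lambda>x. (f x - expectation f)\<^sup>2)" "variance f \<le> v"
    and g: "\<And>x. g x = a + f x / k"
  shows "integrable M g" "expectation g = a + expectation f / k"
    "integrable M (\<lambda>x. (g x - expectation g)\<^sup>2)" "variance g \<le> v / k\<^sup>2"
proof -
  have g_eq: "g = (\<lambda>x. a + f x / k)" by (simp add: g fun_eq_iff)
  show "integrable M g" unfolding g_eq using f by simp
  show e: "expectation g = a + expectation f / k" unfolding g_eq using f by (simp add: prob_space)
  have eq: "(g x - (a + expectation f / k))\<^sup>2 = (f x - expectation f)\<^sup>2 / k\<^sup>2" for x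
    by (simp add: g diff_divide_distrib[symmetric] power_divide)
  show "integrable M (\<lambda>x. (g x - expectation g)\<^sup>2)" "variance g \<le> v / k\<^sup>2"
    unfolding e eq using f by (simp_all add: divide_right_mono)
qed

text \<open>Jensen's inequality, from the tangent of the logarithm at the mean:
  \<open>ln z \<le> z - 1\<close> at \<open>z = X / m\<close>, where the linear term has mean
  zero.\<close>

lemma expectation_ln_le:
  fixes X :: "'a \<Rightarrow> real"
  assumes X: "integrable M X" "AE x in M. X x > 0" and ln: "integrable M (\<lambda>x. ln (X x))"
    and pos: "expectation X > 0"
  shows "expectation (\<lambda>x. ln (X x)) \<le> ln (expectation X)"
proof -
  define m where "m = expectation X"
  have "expectation (\<lambda>x. ln (X x)) \<le> expectation (\<lambda>x. ln m + (X x / m - 1))"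
  proof (rule integral_mono_AE)
    show "AE x in M. ln (X x) \<le> ln m + (X x / m - 1)"
      using X(2)
    proof eventually_elim
      case (elim x)
      then have "ln (X x / m) \<le> X x / m - 1"
        using pos by (intro ln_le_minus_one) (simp add: m_def)
      then show ?case
        using elim pos by (simp add: ln_div m_def)
    qed
  qed (use X ln in auto)
  also have "\<dots> = ln m"
    using X pos by (simp add: m_def prob_space)
  finally show ?thesis by (simp add: m_def)
qed

text \<open>The reverse of Jensen's inequality up to a variance. The inequality
  \<open>ln z \<le> z - 1\<close> is applied at \<open>z = m / X\<close>, and the lower bound 1 on
  \<open>X\<close>, hence on its mean, controls the remainder.\<close>

lemma expectation_ln_ge:
  fixes X :: "'a \<Rightarrow> real"
  assumes X: "integrable M X" "\<And>x. X x \<ge> 1" and sq: "integrable M (\<lambda>x. (X x - expectation X)\<^sup>2)"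
  shows "integrable M (\<lambda>x. ln (X x))" "expectation X \<ge> 1"
    "expectation (\<lambda>x. ln (X x)) \<ge> ln (expectation X) - variance X"
proof -
  have [measurable]: "X \<in> borel_measurable M" using X by auto
  have pos: "X x > 0" for x using X(2)[of x] by linarith
  show int: "integrable M (\<lambda>x. ln (X x))"
    by (rule Bochner_Integration.integrable_bound[OF X(1)])
      (use X(2) in \<open>auto intro!: AE_I2 simp: abs_of_nonneg order_trans[OF ln_le_minus_one[OF pos]]\<close>)
  define m where "m = expectation X"
  have "expectation X \<ge> expectation (\<lambda>x. 1)"
    by (rule integral_mono) (use X in auto)
  then show m1: "expectation X \<ge> 1" by (simp add: prob_space)
  have "expectation (\<lambda>x. ln (X x)) \<ge> expectation (\<lambda>x. ln m + (X x - m) / m - (X x - m)\<^sup>2)"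
  proof (rule integral_mono)
    fix x
    have "ln (m / X x) \<le> m / X x - 1"
      using pos m1 by (intro ln_le_minus_one) (simp add: m_def)
    then have "ln (X x) - ln m \<ge> (X x - m) / X x"
      using pos[of x] m1 by (simp add: ln_div m_def diff_divide_distrib)
    \<comment> \<open>The linear part has mean zero; the quadratic remainder is at most the squared
      deviation because \<open>m\<close> and \<open>X x\<close> are at least 1.\<close>
    also have "(X x - m) / X x = (X x - m) / m - (X x - m)\<^sup>2 / (m * X x)"
      using pos[of x] m1 by (simp add: m_def field_simps power2_eq_square)
    finally have "(X x - m) / m - (X x - m)\<^sup>2 / (m * X x) \<le> ln (X x) - ln m" .
    moreover have "(X x - m)\<^sup>2 / (m * X x) \<le> (X x - m)\<^sup>2 / 1"
      using mult_mono[of 1 m 1 "X x"] X(2)[of x] m1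
      by (intro divide_left_mono) (auto simp: m_def)
    ultimately show "ln m + (X x - m) / m - (X x - m)\<^sup>2 \<le> ln (X x)" by simp
  qed (use int X sq in \<open>auto simp: m_def\<close>)
  also have "expectation (\<lambda>x. ln m + (X x - m) / m - (X x - m)\<^sup>2) = ln m - variance X"
    using X sq by (simp add: m_def prob_space)
  finally show "expectation (\<lambda>x. ln (X x)) \<ge> ln (expectation X) - variance X"
    by (simp add: m_def)
qed

text \<open>The scale \<open>c\<close> may come arbitrarily close to 0, so \<open>c\<close>
  dominates the positive part of the logarithm and \<open>1 / c\<close> the negative part.\<close>

lemma integrable_ln:
  fixes c :: "'a \<Rightarrow> real"
  assumes c: "integrable M c" "integrable M (\<lambda>x. inverse (c x))" and pos: "AE x in M. c x > 0"
  shows "integrable M (\<lambda>x. ln (c x))"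
proof (rule Bochner_Integration.integrable_bound)
  show "integrable M (\<lambda>x. c x + inverse (c x))" using c by auto
  have [measurable]: "c \<in> borel_measurable M" using c by auto
  show "(\<lambda>x. ln (c x)) \<in> borel_measurable M" by measurable
  show "AE x in M. norm (ln (c x)) \<le> norm (c x + inverse (c x))"
    using pos
  proof eventually_elim
    case (elim x)
    have "ln (c x) \<le> c x - 1" "ln (inverse (c x)) \<le> inverse (c x) - 1"
      using elim by (auto intro!: ln_le_minus_one simp del: ln_inverse)
    moreover have "inverse (c x) > 0" using elim by simp
    ultimately have "\<bar>ln (c x)\<bar> \<le> c x + inverse (c x)"
      using elim unfolding ln_inverse by linarith
    then show ?case by simp
  qed
qed

text \<open>The excess \<open>ln c + A / c - 1 - ln A\<close> is at most \<open>(A - c)\<^sup>2 / (A c)\<close>, but fourth moments are not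
  available to bound its mean. Covariances of pairs among \<open>A\<close>, \<open>c\<close>, \<open>1 / c\<close> reduce it to the
  same expression in the means.\<close>

lemma expected_excess_le:
  fixes A c :: "'a \<Rightarrow> real"
  assumes A: "integrable M A" "\<And>x. A x \<ge> 1" "integrable M (\<lambda>x. (A x - expectation A)\<^sup>2)"
      "variance A \<le> v"
    and c: "integrable M c" "AE x in M. c x > 0" "integrable M (\<lambda>x. (c x - expectation c)\<^sup>2)"
      "variance c \<le> v"
    and i: "integrable M (\<lambda>x. inverse (c x))"
      "integrable M (\<lambda>x. (inverse (c x) - expectation (\<lambda>x. inverse (c x)))\<^sup>2)"
      "variance (\<lambda>x. inverse (c x)) \<le> v"
    and d: "\<bar>expectation c - expectation A\<bar> \<le> d" "d \<le> 1 / 2"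
    and K: "expectation A \<le> K" and v: "v \<ge> 0"
  shows "integrable M (\<lambda>x. ln (c x) + A x / c x - 1)"
    "expectation (\<lambda>x. ln (c x) + A x / c x - 1) - expectation (\<lambda>x. ln (A x))
       \<le> 2 * d\<^sup>2 + 2 * v + 2 * K * v"
proof -
  define a b h where "a = expectation A" and "b = expectation c"
    and "h = expectation (\<lambda>x. inverse (c x))"
  note lnA = expectation_ln_ge[OF A(1-3)]
  have a: "a \<ge> 1" using lnA by (simp add: a_def)
  \<comment> \<open>The bias is at most 1/2 and \<open>a\<close> is at least 1, so the mean of
    \<open>c\<close> stays away from 0 and divisions by \<open>b\<close> cost at most a factor
    2.\<close>
  have b: "b \<ge> 1 / 2" using d a by (simp add: a_def b_def)
  have lnc: "integrable M (\<lambda>x. ln (c x))" by (rule integrable_ln[OF c(1) i(1) c(2)])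
  note covA = covariance_bound[OF A(1,3,4) i]
  note covc = covariance_bound[OF c(1,3,4) i]
  show "integrable M (\<lambda>x. ln (c x) + A x / c x - 1)"
    using lnc covA(1) by (simp add: divide_inverse)
  \<comment> \<open>The product of \<open>c\<close> and \<open>1 / c\<close> is almost surely 1, so
    their covariance bound limits how far the mean of \<open>1 / c\<close> can exceed
    \<open>1 / b\<close>.\<close>
  have "expectation (\<lambda>x. c x * inverse (c x)) = expectation (\<lambda>x. 1)"
    by (rule integral_cong_AE) (use c in auto)
  then have "b * h \<le> 1 + v"
    using covc(2) by (simp add: prob_space b_def h_def)
  then have h: "h \<le> (1 + v) / b"
    using b by (simp add: field_simps)
  have "expectation (\<lambda>x. ln (c x) + A x / c x - 1) - expectation (\<lambda>x. ln (A x))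
      = expectation (\<lambda>x. ln (c x)) + expectation (\<lambda>x. A x * inverse (c x)) - 1
        - expectation (\<lambda>x. ln (A x))"
    using lnc covA(1) by (simp add: divide_inverse prob_space)
  also have "\<dots> \<le> ln b + (a * h + v) - 1 - (ln a - v)"
    using expectation_ln_le[OF c(1,2) lnc] b covA(2) lnA(3) A(4)
    by (simp add: a_def b_def h_def)
  also have "a * h \<le> a * ((1 + v) / b)"
    using h a by (intro mult_left_mono) auto
  also have "ln b + (a * ((1 + v) / b) + v) - 1 - (ln a - v)
      \<le> (b / a - 1) + (a * ((1 + v) / b) + v) - 1 + v"
    using ln_le_minus_one[of "b / a"] a b by (simp add: ln_div)
  \<comment> \<open>Here \<open>b / a + a / b - 2\<close> is a perfect square over
    \<open>a * b\<close>, which is why the bias enters only through its square.\<close>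
  also have "\<dots> = (b - a)\<^sup>2 / (a * b) + 2 * v + a * v / b"
    using a b by (simp add: field_simps power2_eq_square)
  also have "(b - a)\<^sup>2 / (a * b) \<le> d\<^sup>2 / (1 / 2)"
  proof (rule frac_le)
    show "(b - a)\<^sup>2 \<le> d\<^sup>2"
      using d by (simp add: a_def b_def abs_le_square_iff[symmetric])
    show "1 / 2 \<le> a * b"
      using mult_mono[of 1 a "1 / 2" b] a b by simp
  qed auto
  also have "a * v / b \<le> (K * v) / (1 / 2)"
    using K a b v by (intro frac_le mult_right_mono mult_nonneg_nonneg) (auto simp: a_def)
  finally show "expectation (\<lambda>x. ln (c x) + A x / c x - 1) - expectation (\<lambda>x. ln (A x))
       \<le> 2 * d\<^sup>2 + 2 * v + 2 * K * v"
    by (simp add: algebra_simps)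
qed

end

section \<open>Divergence between Gaussian laws\<close>

interpretation lborel_product: product_sigma_finite "\<lambda>_::nat. lborel :: real measure"
  by standard

lemma measurable_leb_component [measurable]: "i < n \<Longrightarrow> (\<lambda>x. x i) \<in> borel_measurable (leb n)"
  unfolding leb_def by measurable

lemma sets_gauss [measurable_cong, simp]: "sets (gauss n \<mu> v) = sets (leb n)"
  by (simp add: gauss_def)

lemma measurable_gauss_density [measurable]: "gauss_density n \<mu> v \<in> borel_measurable (leb n)"
  unfolding gauss_density_def[abs_def] by measurable

lemma measurable_sqdist:
  assumes [measurable]: "t \<in> leb n \<rightarrow>\<^sub>M leb n"
  shows "(\<lambda>x. sqdist n (t x) \<theta>) \<in> borel_measurable (leb n)"
proof -
  have [measurable]: "(\<lambda>x. t x i) \<in> borel_measurable (leb n)" if "i < n" for i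
    using measurable_compose[OF assms measurable_leb_component[OF that]] .
  show ?thesis unfolding sqdist_def by measurable
qed

lemma gauss_density_pos: "v > 0 \<Longrightarrow> gauss_density n \<mu> v y > 0"
  unfolding gauss_density_def by (intro prod_pos) (auto intro: normal_density_pos)

lemma prob_space_gauss:
  assumes "v > 0"
  shows "prob_space (gauss n \<mu> v)"
proof
  have nn: "(\<integral>\<^sup>+x. ennreal (normal_density m (sqrt v) x) \<partial>lborel) = 1" for m
    using assms by (subst nn_integral_eq_integral) (auto simp: normal_density_nonneg)
  have "emeasure (gauss n \<mu> v) (space (gauss n \<mu> v))
      = (\<integral>\<^sup>+y. (\<Prod>i<n. ennreal (normal_density (\<mu> i) (sqrt v) (y i))) \<partial>(\<Pi>\<^sub>M i\<in>{..<n}. lborel))"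
    unfolding gauss_def
    by (subst emeasure_density)
      (auto simp: gauss_density_def prod_ennreal normal_density_nonneg leb_def[symmetric]
            intro!: nn_integral_cong)
  also have "\<dots> = (\<Prod>i<n. \<integral>\<^sup>+y. ennreal (normal_density (\<mu> i) (sqrt v) y) \<partial>lborel)"
    by (rule lborel_product.product_nn_integral_prod) auto
  finally show "emeasure (gauss n \<mu> v) (space (gauss n \<mu> v)) = 1"
    by (simp add: nn)
qed

section \<open>The divergence in one dimension and in \<open>n\<close> dimensions\<close>

lemma normal_ln_ratio:
  assumes "v > 0" "w > 0"
  shows "ln (normal_density m (sqrt v) y / normal_density l (sqrt w) y)
    = (ln (w / v) - (y - m)\<^sup>2 / v + (y - l)\<^sup>2 / w) / 2"
proof -
  have ln: "ln (normal_density m (sqrt v) y) = - ln (2 * pi * v) / 2 - (y - m)\<^sup>2 / (2 * v)" if "v > 0" for m v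
    using that by (simp add: normal_density_def ln_mult ln_div ln_sqrt add_divide_distrib)
  have "normal_density m (sqrt v) y > 0" "normal_density l (sqrt w) y > 0"
    using assms by (auto intro: normal_density_pos)
  then show ?thesis
    using assms by (simp add: ln_div ln[of v] ln[of w] ln_mult add_divide_distrib diff_divide_distrib)
qed

text \<open>The logarithm of the ratio is a quadratic polynomial in \<open>y - m\<close>, so the
  moments of order 0, 1 and 2 of the first law determine the integral.\<close>

lemma has_bochner_integral_normal_ln_ratio:
  assumes "v > 0" "w > 0"
  shows "has_bochner_integral lborel
    (\<lambda>y. normal_density m (sqrt v) y * ln (normal_density m (sqrt v) y / normal_density l (sqrt w) y))
    ((ln (w / v) - 1 + (v + (m - l)\<^sup>2) / w) / 2)"
proof -
  let ?p = "normal_density m (sqrt v)"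
  have s: "sqrt v > 0" using assms by simp
  have 0: "has_bochner_integral lborel ?p 1"
    using normal_moment_even[OF s, of m 0] by simp
  have 1: "has_bochner_integral lborel (\<lambda>y. ?p y * (y - m)) 0"
    using normal_moment_odd[OF s, of m 0] by simp
  have 2: "has_bochner_integral lborel (\<lambda>y. ?p y * (y - m)\<^sup>2) v"
    using normal_moment_even[OF s, of m 1] assms by simp
  \<comment> \<open>The coefficients come from writing \<open>y - l\<close> as
    \<open>(y - m) + (m - l)\<close> and collecting powers of \<open>y - m\<close>.\<close>
  have "has_bochner_integral lborel
      (\<lambda>y. ?p y * ((ln (w / v) + (m - l)\<^sup>2 / w) / 2) + ?p y * (y - m) * ((m - l) / w)
        + ?p y * (y - m)\<^sup>2 * ((1 / w - 1 / v) / 2))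
      (1 * ((ln (w / v) + (m - l)\<^sup>2 / w) / 2) + 0 * ((m - l) / w) + v * ((1 / w - 1 / v) / 2))"
    by (intro has_bochner_integral_add has_bochner_integral_mult_left 0 1 2)
  also have "(\<lambda>y. ?p y * ((ln (w / v) + (m - l)\<^sup>2 / w) / 2) + ?p y * (y - m) * ((m - l) / w)
        + ?p y * (y - m)\<^sup>2 * ((1 / w - 1 / v) / 2))
      = (\<lambda>y. ?p y * ln (?p y / normal_density l (sqrt w) y))"
    unfolding normal_ln_ratio[OF assms]
    using assms by (auto simp: field_simps power2_eq_square)
  also have "1 * ((ln (w / v) + (m - l)\<^sup>2 / w) / 2) + 0 * ((m - l) / w) + v * ((1 / w - 1 / v) / 2)
      = (ln (w / v) - 1 + (v + (m - l)\<^sup>2) / w) / 2"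
    using assms by (simp add: field_simps)
  finally show ?thesis .
qed

text \<open>The logarithm of a ratio of products is a sum over coordinates. In each summand Fubini's
  theorem leaves one one-dimensional divergence, since the other factors are densities of mass
  1.\<close>

lemma gauss_kl:
  assumes "v > 0" "w > 0"
  shows "has_bochner_integral (leb n)
    (\<lambda>y. gauss_density n \<theta> v y * ln (gauss_density n \<theta> v y / gauss_density n \<mu> w y))
    ((real n * (ln (w / v) - 1 + v / w) + sqdist n \<mu> \<theta> / w) / 2)"
proof -
  define p where "p i = normal_density (\<theta> i) (sqrt v)" for i
  define f where "f i y = ln (p i y / normal_density (\<mu> i) (sqrt w) y)" for i y
  \<comment> \<open>\<open>h i j\<close> is the \<open>j\<close>-th factor of the
    \<open>i\<close>-th summand; only the factor with \<open>j = i\<close> carries a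
    logarithm.\<close>
  define h where "h i j y = p j y * (if j = i then f i y else 1)" for i j y
  define k where "k i = (ln (w / v) - 1 + (v + (\<theta> i - \<mu> i)\<^sup>2) / w) / 2" for i
  have pos: "p i y > 0" "normal_density (\<mu> i) (sqrt w) y > 0" for i y
    using assms by (auto simp: p_def normal_density_pos)
  have h: "has_bochner_integral lborel (h i j) (if j = i then k i else 1)" for i j
    using has_bochner_integral_normal_ln_ratio[OF assms, of "\<theta> i" "\<mu> i"]
      normal_moment_even[of "sqrt v" "\<theta> j" 0] assms
    by (auto simp: h_def[abs_def] p_def f_def k_def)
  have hk: "has_bochner_integral (leb n) (\<lambda>y. \<Prod>j<n. h i j (y j)) (k i)" if "i < n" for i
    unfolding has_bochner_integral_iff leb_def
  proof
    show "integrable (\<Pi>\<^sub>M i\<in>{..<n}. lborel) (\<lambda>y. \<Prod>j<n. h i j (y j))"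
      by (rule lborel_product.product_integrable_prod) (use h in \<open>auto intro: integrable.intros\<close>)
    have "(\<integral>y. (\<Prod>j<n. h i j (y j)) \<partial>(\<Pi>\<^sub>M i\<in>{..<n}. lborel)) = (\<Prod>j<n. integral\<^sup>L lborel (h i j))"
      by (rule lborel_product.product_integral_prod) (use h in \<open>auto intro: integrable.intros\<close>)
    also have "\<dots> = (\<Prod>j<n. if j = i then k i else 1)"
      by (intro prod.cong refl has_bochner_integral_integral_eq h)
    also have "\<dots> = k i" using that by (simp add: prod.delta)
    finally show "(\<integral>y. (\<Prod>j<n. h i j (y j)) \<partial>(\<Pi>\<^sub>M i\<in>{..<n}. lborel)) = k i" .
  qed
  have "has_bochner_integral (leb n) (\<lambda>y. \<Sum>i<n. \<Prod>j<n. h i j (y j)) (\<Sum>i<n. k i)"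
    by (rule has_bochner_integral_sum) (use hk in auto)
  also have "(\<lambda>y. \<Sum>i<n. \<Prod>j<n. h i j (y j))
      = (\<lambda>y. gauss_density n \<theta> v y * ln (gauss_density n \<theta> v y / gauss_density n \<mu> w y))"
  proof
    fix y
    have "ln (gauss_density n \<theta> v y / gauss_density n \<mu> w y) = (\<Sum>i<n. f i (y i))"
      unfolding gauss_density_def prod_dividef[symmetric] f_def p_def[symmetric]
      by (subst ln_prod) (use pos[THEN less_imp_neq, THEN not_sym] in auto)
    moreover have "(\<Prod>j<n. h i j (y j)) = gauss_density n \<theta> v y * f i (y i)" if "i < n" for i
      using that by (simp add: h_def prod.distrib gauss_density_def p_def prod.delta
          if_distrib[of "\<lambda>g. g _"] cong: if_cong)
    ultimately show "(\<Sum>i<n. \<Prod>j<n. h i j (y j))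
        = gauss_density n \<theta> v y * ln (gauss_density n \<theta> v y / gauss_density n \<mu> w y)"
      by (simp add: sum_distrib_left)
  qed
  also have "(\<Sum>i<n. k i) = (real n * (ln (w / v) - 1 + v / w) + sqdist n \<mu> \<theta> / w) / 2"
    by (simp add: k_def sqdist_def sum.distrib sum_subtractf sum_divide_distrib[symmetric] add_divide_distrib
        power2_commute[of "\<mu> _"] algebra_simps)
  finally show ?thesis .
qed

section \<open>Extended integrals and closed forms of the risks\<close>

lemma ext_integral_eq_integral:
  assumes "integrable M f"
  shows "ext_integral M (\<lambda>x. ereal (f x)) = ereal (\<integral>x. f x \<partial>M)"
proof -
  have fin: "(\<integral>\<^sup>+x. ennreal (f x) \<partial>M) \<noteq> \<infinity>" "(\<integral>\<^sup>+x. ennreal (- f x) \<partial>M) \<noteq> \<infinity>"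
    using assms by (auto simp: real_integrable_def)
  then obtain a b where "(\<integral>\<^sup>+x. ennreal (f x) \<partial>M) = ennreal a" "(\<integral>\<^sup>+x. ennreal (- f x) \<partial>M) = ennreal b"
    "a \<ge> 0" "b \<ge> 0"
    by (metis ennreal_cases infinity_ennreal_def)
  then show ?thesis
    by (simp add: ext_integral_def real_lebesgue_integral_def[OF assms])
qed

lemma ext_integral_cong_AE:
  assumes "AE x in M. f x = g x"
  shows "ext_integral M f = ext_integral M g"
  unfolding ext_integral_def using assms
  by (intro arg_cong2[where f = minus] arg_cong[where f = enn2ereal] nn_integral_cong_AE) auto

text \<open>The positive part increases and the negative part decreases, so the comparison also
  covers scale estimates of infinite risk.\<close>

lemma ext_integral_mono_AE:
  assumes "AE x in M. f x \<le> g x"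
  shows "ext_integral M f \<le> ext_integral M g"
  unfolding ext_integral_def using assms
  by (intro ereal_minus_mono less_eq_ennreal.rep_eq[THEN iffD1] nn_integral_mono_AE)
    (auto elim!: eventually_mono intro: e2ennreal_mono)

text \<open>Where \<open>c x > 0\<close> the estimate is a positive density, so the infinite branch
  is not met and the inner integral is the Gaussian divergence. The exceptional \<open>x\<close>
  form a null set.\<close>

lemma pred_risk_gauss_pde:
  assumes r: "r > 0" and n: "n > 0" and c: "AE x in gauss n \<theta> 1. c x > 0"
  shows "pred_risk n r \<theta> (gauss_pde n r t c) = ext_integral (gauss n \<theta> 1)
    (\<lambda>x. ereal (real n / 2 * (ln (c x) + (1 + sqdist n (t x) \<theta> / (real n * r)) / c x - 1)))"
  unfolding pred_risk_def
proof (rule ext_integral_cong_AE, use c in eventually_elim)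
  case (elim x)
  note kl = gauss_kl[OF r, of "c x * r" n \<theta> "t x"]
  have "ext_integral (leb n) (\<lambda>y. if gauss_pde n r t c x y = 0 then \<infinity>
      else ereal (gauss_density n \<theta> r y * ln (gauss_density n \<theta> r y / gauss_pde n r t c x y)))
    = ext_integral (leb n) (\<lambda>y. ereal (gauss_density n \<theta> r y
        * ln (gauss_density n \<theta> r y / gauss_density n (t x) (c x * r) y)))"
    using gauss_density_pos[of "c x * r" n "t x"] elim r
    by (simp add: gauss_pde_def less_imp_neq[THEN not_sym])
  also have "\<dots> = ereal ((real n * (ln (c x) - 1 + 1 / c x) + sqdist n (t x) \<theta> / (c x * r)) / 2)"
    using kl elim r by (subst ext_integral_eq_integral) (auto simp: has_bochner_integral_iff)
  also have "(real n * (ln (c x) - 1 + 1 / c x) + sqdist n (t x) \<theta> / (c x * r)) / 2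
      = real n / 2 * (ln (c x) + (1 + sqdist n (t x) \<theta> / (real n * r)) / c x - 1)"
    using elim r n by (simp add: field_simps)
  finally show ?case .
qed

text \<open>Scale estimates may depend on \<open>\<theta>\<close>, and for each \<open>x\<close> the divergence is least at
  \<open>c = 1 + sqdist n (t x) \<theta> / (n r)\<close>, so the infimum is attained there.\<close>

lemma rho0_eq:
  assumes r: "r > 0" and n: "n > 0" and t: "t \<in> leb n \<rightarrow>\<^sub>M leb n"
  shows "rho0 n r \<theta> t = ext_integral (gauss n \<theta> 1)
    (\<lambda>x. ereal (real n / 2 * ln (1 + sqdist n (t x) \<theta> / (real n * r))))"
proof -
  define A where "A x = 1 + sqdist n (t x) \<theta> / (real n * r)" for x
  have A: "A x > 0" for x
    using r by (auto simp: A_def sqdist_def intro!: add_pos_nonneg divide_nonneg_nonneg sum_nonneg)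
  have "A \<in> borel_measurable (leb n)"
    unfolding A_def[abs_def] using measurable_sqdist[OF t] by measurable
  then have mem: "A \<in> scale_estimates n \<theta>"
    using A by (simp add: scale_estimates_def)
  have risk: "pred_risk n r \<theta> (gauss_pde n r t c)
      = ext_integral (gauss n \<theta> 1) (\<lambda>x. ereal (real n / 2 * (ln (c x) + A x / c x - 1)))"
    if "c \<in> scale_estimates n \<theta>" for c
    using pred_risk_gauss_pde[OF r n, where c = c and \<theta> = \<theta> and t = t] that by (simp add: scale_estimates_def A_def)
  have "rho0 n r \<theta> t = ext_integral (gauss n \<theta> 1) (\<lambda>x. ereal (real n / 2 * ln (A x)))"
    unfolding rho0_def
  proof (rule antisym)
    \<comment> \<open>At \<open>c = A\<close> the terms \<open>A / c - 1\<close> cancel, leaving the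
      logarithm alone.\<close>
    show "(INF c\<in>scale_estimates n \<theta>. pred_risk n r \<theta> (gauss_pde n r t c))
        \<le> ext_integral (gauss n \<theta> 1) (\<lambda>x. ereal (real n / 2 * ln (A x)))"
      by (rule INF_lower2[OF mem]) (use A in \<open>simp add: risk[OF mem] less_imp_neq[THEN not_sym]\<close>)
    show "ext_integral (gauss n \<theta> 1) (\<lambda>x. ereal (real n / 2 * ln (A x)))
        \<le> (INF c\<in>scale_estimates n \<theta>. pred_risk n r \<theta> (gauss_pde n r t c))"
    proof (rule INF_greatest)
      fix c assume c: "c \<in> scale_estimates n \<theta>"
      then have "AE x in gauss n \<theta> 1. c x > 0" by (simp add: scale_estimates_def)
      then have "AE x in gauss n \<theta> 1. ereal (real n / 2 * ln (A x))
          \<le> ereal (real n / 2 * (ln (c x) + A x / c x - 1))"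
      proof eventually_elim
        case (elim x)
        have "ln (A x) \<le> ln (c x) + A x / c x - 1"
          using ln_le_minus_one[of "A x / c x"] A[of x] elim by (simp add: ln_div)
        then show ?case by (simp add: mult_left_mono)
      qed
      then show "ext_integral (gauss n \<theta> 1) (\<lambda>x. ereal (real n / 2 * ln (A x)))
          \<le> pred_risk n r \<theta> (gauss_pde n r t c)"
        unfolding risk[OF c] by (rule ext_integral_mono_AE)
    qed
  qed
  then show ?thesis by (simp add: A_def)
qed

section \<open>Asymptotics of the risk\<close>

text \<open>Division of the loss by \<open>n r\<close> turns the variance bound \<open>C n\<close>
  into \<open>C / (r^2 n)\<close>, and nonnegativity of the loss keeps \<open>A\<close> at or above
  1.\<close>

lemma scaled_loss_moments:
  assumes r: "r > 0" and n: "n > 0" and t: "t \<in> leb n \<rightarrow>\<^sub>M leb n"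
    and var: "ext_variance (gauss n \<theta> 1) (\<lambda>x. sqdist n (t x) \<theta>) \<le> ennreal (C * real n)"
    and C: "C \<ge> 0"
  defines "A \<equiv> \<lambda>x. 1 + sqdist n (t x) \<theta> / (real n * r)"
  shows "integrable (gauss n \<theta> 1) A" "A x \<ge> 1"
    "(\<integral>x. A x \<partial>gauss n \<theta> 1) = 1 + enn2real (quad_risk n \<theta> t) / (real n * r)"
    "integrable (gauss n \<theta> 1) (\<lambda>x. (A x - (\<integral>x. A x \<partial>gauss n \<theta> 1))\<^sup>2)"
    "(\<integral>x. (A x - (\<integral>x. A x \<partial>gauss n \<theta> 1))\<^sup>2 \<partial>gauss n \<theta> 1) \<le> C / r\<^sup>2 / real n"
proof -
  interpret prob_space "gauss n \<theta> 1" by (rule prob_space_gauss) simp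
  have m: "(\<lambda>x. sqdist n (t x) \<theta>) \<in> borel_measurable (gauss n \<theta> 1)"
    using measurable_sqdist[OF t] by (simp cong: measurable_cong_sets)
  have "C * real n \<ge> 0" using C by simp
  note sq = square_integrable_of_ext_variance[OF prob_space_axioms m var this]
  note A = affine_moments[OF sq, of A 1 "real n * r", OF A_def[THEN meta_eq_to_obj_eq, THEN fun_cong]]
  show "integrable (gauss n \<theta> 1) A"
    "integrable (gauss n \<theta> 1) (\<lambda>x. (A x - (\<integral>x. A x \<partial>gauss n \<theta> 1))\<^sup>2)"
    by (fact A)+
  show "(\<integral>x. (A x - (\<integral>x. A x \<partial>gauss n \<theta> 1))\<^sup>2 \<partial>gauss n \<theta> 1) \<le> C / r\<^sup>2 / real n"
    using A(4) n by (simp add: power_mult_distrib power2_eq_square field_simps)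
  show "A x \<ge> 1"
    using r by (auto simp: A_def sqdist_def intro!: divide_nonneg_nonneg sum_nonneg)
  have "(\<integral>x. sqdist n (t x) \<theta> \<partial>gauss n \<theta> 1) = enn2real (quad_risk n \<theta> t)"
    unfolding quad_risk_def
    by (rule integral_eq_nn_integral[OF m]) (simp add: sqdist_def sum_nonneg)
  then show "(\<integral>x. A x \<partial>gauss n \<theta> 1) = 1 + enn2real (quad_risk n \<theta> t) / (real n * r)"
    using A(2) by simp
qed

text \<open>Raising the constant to \<open>max C 0\<close> only weakens the bound. A nonnegative
  constant lets an inequality in \<open>ennreal\<close> be read as one between reals.\<close>

lemma ennreal_bound_nonneg:
  assumes "\<exists>C. \<forall>\<^sub>F n in F. (f n :: ennreal) \<le> ennreal (C * g n)" and g: "\<And>n. g n \<ge> 0"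
  shows "\<exists>C\<ge>0. \<forall>\<^sub>F n in F. f n \<le> ennreal (C * g n)"
proof -
  obtain C where "\<forall>\<^sub>F n in F. f n \<le> ennreal (C * g n)" using assms by blast
  then have "\<forall>\<^sub>F n in F. f n \<le> ennreal (max C 0 * g n)"
    by eventually_elim (auto elim!: order_trans intro!: ennreal_leI mult_right_mono g)
  then show ?thesis by (intro exI[of _ "max C 0"]) auto
qed

lemma class_A_bounds:
  assumes "t \<in> class_A r"
  obtains q v where "q \<ge> 0" "v \<ge> 0"
    "\<forall>\<^sub>F n in sequentially. n > 0 \<and> t n \<in> leb n \<rightarrow>\<^sub>M leb n \<and>
      quad_risk n \<theta> (t n) \<le> ennreal (q * real n) \<and>
      ext_variance (gauss n \<theta> 1) (\<lambda>x. sqdist n (t n x) \<theta>) \<le> ennreal (v * real n)"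
proof -
  have "\<exists>C. \<forall>\<^sub>F n in sequentially. quad_risk n \<theta> (t n) \<le> ennreal (C * real n)"
    "\<exists>C. \<forall>\<^sub>F n in sequentially.
      ext_variance (gauss n \<theta> 1) (\<lambda>x. sqdist n (t n x) \<theta>) \<le> ennreal (C * real n)"
    and meas: "\<forall>n\<ge>1. t n \<in> leb n \<rightarrow>\<^sub>M leb n"
    using assms by (auto simp: class_A_def)
  from this(1,2)[THEN ennreal_bound_nonneg] obtain q v where qv: "q \<ge> 0" "v \<ge> 0"
    "\<forall>\<^sub>F n in sequentially. quad_risk n \<theta> (t n) \<le> ennreal (q * real n)"
    "\<forall>\<^sub>F n in sequentially.
      ext_variance (gauss n \<theta> 1) (\<lambda>x. sqdist n (t n x) \<theta>) \<le> ennreal (v * real n)"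
    by auto
  have "\<forall>\<^sub>F n in sequentially. n > 0 \<and> t n \<in> leb n \<rightarrow>\<^sub>M leb n \<and>
      quad_risk n \<theta> (t n) \<le> ennreal (q * real n) \<and>
      ext_variance (gauss n \<theta> 1) (\<lambda>x. sqdist n (t n x) \<theta>) \<le> ennreal (v * real n)"
    using qv(3,4) eventually_gt_at_top[of 0] by eventually_elim (use meas in auto)
  then show thesis using that qv(1,2) by blast
qed

lemma suitable_risk_estimate_bounds:
  assumes "suitable_risk_estimate r t U"
  obtains b v w where "b \<ge> 0" "v \<ge> 0" "w \<ge> 0"
    "\<forall>\<^sub>F n in sequentially. U n \<in> borel_measurable (leb n) \<and>
      (AE x in gauss n \<theta> 1. plugin_scale n r (U n) x > 0) \<and>
      \<bar>(\<integral>x. U n x \<partial>gauss n \<theta> 1) - enn2real (quad_risk n \<theta> (t n))\<bar> \<le> b * sqrt (real n) \<and>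
      ext_variance (gauss n \<theta> 1) (U n) \<le> ennreal (v * real n) \<and>
      ext_variance (gauss n \<theta> 1) (\<lambda>x. inverse (plugin_scale n r (U n) x)) \<le> ennreal (w / real n)"
proof -
  have meas: "\<forall>n\<ge>1. U n \<in> borel_measurable (leb n)"
    and pos: "\<forall>n\<ge>1. AE x in gauss n \<theta> 1. plugin_scale n r (U n) x > 0"
    and bias: "\<exists>C. \<forall>\<^sub>F n in sequentially.
      \<bar>(\<integral>x. U n x \<partial>gauss n \<theta> 1) - enn2real (quad_risk n \<theta> (t n))\<bar> \<le> C * sqrt (real n)"
    and var: "\<exists>C. \<forall>\<^sub>F n in sequentially. ext_variance (gauss n \<theta> 1) (U n) \<le> ennreal (C * real n)"
      \<comment> \<open>Written as \<open>C * (1 / real n)\<close> to match the shape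
        \<open>C * g n\<close> of \<open>ennreal_bound_nonneg\<close>.\<close>
      "\<exists>C. \<forall>\<^sub>F n in sequentially. ext_variance (gauss n \<theta> 1)
        (\<lambda>x. inverse (plugin_scale n r (U n) x)) \<le> ennreal (C * (1 / real n))"
    using assms by (auto simp: suitable_risk_estimate_def)
  obtain v where v: "v \<ge> 0"
    "\<forall>\<^sub>F n in sequentially. ext_variance (gauss n \<theta> 1) (U n) \<le> ennreal (v * real n)"
    using ennreal_bound_nonneg[OF var(1)] by auto
  obtain w where w: "w \<ge> 0"
    "\<forall>\<^sub>F n in sequentially. ext_variance (gauss n \<theta> 1)
        (\<lambda>x. inverse (plugin_scale n r (U n) x)) \<le> ennreal (w * (1 / real n))"
    using ennreal_bound_nonneg[OF var(2)] by auto
  obtain b where b: "\<forall>\<^sub>F n in sequentially.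
      \<bar>(\<integral>x. U n x \<partial>gauss n \<theta> 1) - enn2real (quad_risk n \<theta> (t n))\<bar> \<le> b * sqrt (real n)"
    using bias by blast
  have "\<forall>\<^sub>F n in sequentially. U n \<in> borel_measurable (leb n) \<and>
      (AE x in gauss n \<theta> 1. plugin_scale n r (U n) x > 0) \<and>
      \<bar>(\<integral>x. U n x \<partial>gauss n \<theta> 1) - enn2real (quad_risk n \<theta> (t n))\<bar> \<le> \<bar>b\<bar> * sqrt (real n) \<and>
      ext_variance (gauss n \<theta> 1) (U n) \<le> ennreal (v * real n) \<and>
      ext_variance (gauss n \<theta> 1) (\<lambda>x. inverse (plugin_scale n r (U n) x)) \<le> ennreal (w / real n)"
    using v(2) w(2) b eventually_gt_at_top[of 0]
  proof eventually_elim
    case (elim n)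
    have "b * sqrt (real n) \<le> \<bar>b\<bar> * sqrt (real n)" by (intro mult_right_mono) auto
    then have "\<bar>(\<integral>x. U n x \<partial>gauss n \<theta> 1) - enn2real (quad_risk n \<theta> (t n))\<bar> \<le> \<bar>b\<bar> * sqrt (real n)"
      using elim by linarith
    with elim meas pos show ?case by simp
  qed
  then show thesis using that[of "\<bar>b\<bar>" v w] v(1) w(1) by simp
qed

text \<open>The two bounds on the mean logarithm differ by the variance of \<open>A\<close>, at most
  \<open>C / (r^2 n)\<close>; the factor \<open>n / 2\<close> turns this into a constant independent
  of \<open>n\<close>.\<close>

lemma rho0_approx:
  assumes r: "r > 0" and n: "n > 0" and t: "t \<in> leb n \<rightarrow>\<^sub>M leb n"
    and var: "ext_variance (gauss n \<theta> 1) (\<lambda>x. sqdist n (t x) \<theta>) \<le> ennreal (C * real n)"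
    and C: "C \<ge> 0"
  shows "rho0 n r \<theta> t
      = ereal (real n / 2 * (\<integral>x. ln (1 + sqdist n (t x) \<theta> / (real n * r)) \<partial>gauss n \<theta> 1))"
    "\<bar>rho0 n r \<theta> t - ereal (real n / 2 * ln (1 + enn2real (quad_risk n \<theta> t) / (real n * r)))\<bar>
      \<le> ereal (C / r\<^sup>2 / 2)"
proof -
  interpret prob_space "gauss n \<theta> 1" by (rule prob_space_gauss) simp
  define A where "A x = 1 + sqdist n (t x) \<theta> / (real n * r)" for x
  note A = scaled_loss_moments[OF r n t var C, folded A_def]
  note ge = expectation_ln_ge[OF A(1,2,4)]
  have le: "expectation (\<lambda>x. ln (A x)) \<le> ln (expectation A)"
    by (rule expectation_ln_le[OF A(1) _ ge(1)])
      (use A(2) ge(2) in \<open>auto intro: less_le_trans[OF zero_less_one]\<close>)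
  show rho: "rho0 n r \<theta> t
      = ereal (real n / 2 * (\<integral>x. ln (1 + sqdist n (t x) \<theta> / (real n * r)) \<partial>gauss n \<theta> 1))"
    unfolding rho0_eq[OF r n t]
    using ge(1) by (subst ext_integral_eq_integral) (simp_all add: A_def)
  have "\<bar>real n / 2 * expectation (\<lambda>x. ln (A x)) - real n / 2 * ln (expectation A)\<bar>
      = real n / 2 * \<bar>expectation (\<lambda>x. ln (A x)) - ln (expectation A)\<bar>"
    unfolding right_diff_distrib[symmetric] abs_mult by simp
  also have "\<dots> \<le> real n / 2 * (C / r\<^sup>2 / real n)"
    using le ge(3) A(5) by (intro mult_left_mono) auto
  finally show "\<bar>rho0 n r \<theta> t
      - ereal (real n / 2 * ln (1 + enn2real (quad_risk n \<theta> t) / (real n * r)))\<bar>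
      \<le> ereal (C / r\<^sup>2 / 2)"
    unfolding rho using n by (simp add: A(3)[symmetric]) (simp add: A_def)
qed

text \<open>All errors in the mean excess are of order \<open>1 / n\<close>, including the square of
  the scaled bias, so multiplication by \<open>n / 2\<close> leaves a constant. The hypothesis
  \<open>large\<close> makes the scaled bias at most 1/2.\<close>

lemma plugin_excess_le:
  assumes r: "r > 0" and n: "n > 0" and t: "t \<in> leb n \<rightarrow>\<^sub>M leb n"
    and q: "quad_risk n \<theta> t \<le> ennreal (q * real n)" "q \<ge> 0"
    and var: "ext_variance (gauss n \<theta> 1) (\<lambda>x. sqdist n (t x) \<theta>) \<le> ennreal (C * real n)" "C \<ge> 0"
    and u: "u \<in> borel_measurable (leb n)" "AE x in gauss n \<theta> 1. plugin_scale n r u x > 0"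
    and bias: "\<bar>(\<integral>x. u x \<partial>gauss n \<theta> 1) - enn2real (quad_risk n \<theta> t)\<bar> \<le> b * sqrt (real n)"
    and uvar: "ext_variance (gauss n \<theta> 1) u \<le> ennreal (v * real n)" "v \<ge> 0"
    and ivar: "ext_variance (gauss n \<theta> 1) (\<lambda>x. inverse (plugin_scale n r u x)) \<le> ennreal (w / real n)"
      "w \<ge> 0"
    and large: "2 * b / r \<le> sqrt (real n)"
  shows "pred_risk n r \<theta> (gauss_pde n r t (plugin_scale n r u)) - rho0 n r \<theta> t
    \<le> ereal ((b / r)\<^sup>2 + (2 + q / r) * ((C + v) / r\<^sup>2 + w))"
proof -
  interpret prob_space "gauss n \<theta> 1" by (rule prob_space_gauss) simp
  define A where "A x = 1 + sqdist n (t x) \<theta> / (real n * r)" for x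
  define c where "c = plugin_scale n r u"
  \<comment> \<open>\<open>V / n\<close> is a common bound for the variances of \<open>A\<close>,
    \<open>c\<close> and \<open>1 / c\<close>.\<close>
  define V where "V = (C + v) / r\<^sup>2 + w"
  \<comment> \<open>The bias bound \<open>b * sqrt n\<close> of the risk estimate after division by
    \<open>n r\<close>.\<close>
  define d where "d = b / r / sqrt (real n)"
  \<comment> \<open>A bound on the mean of \<open>A\<close>, from a quadratic risk of at most
    \<open>q n\<close>.\<close>
  define K where "K = 1 + q / r"
  have n': "real n > 0" using n by simp
  note A = scaled_loss_moments[OF r n t var, folded A_def]
  have um: "u \<in> borel_measurable (gauss n \<theta> 1)"
    using u(1) by (simp cong: measurable_cong_sets)
  then have cm: "(\<lambda>x. inverse (c x)) \<in> borel_measurable (gauss n \<theta> 1)"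
    unfolding c_def plugin_scale_def by measurable
  have c_eq: "c x = 1 + u x / (real n * r)" for x
    by (simp add: c_def plugin_scale_def)
  have "v * real n \<ge> 0" using uvar(2) by simp
  note c = affine_moments[OF square_integrable_of_ext_variance[OF prob_space_axioms um uvar(1) this] c_eq]
  have "w / real n \<ge> 0" using ivar(2) by simp
  note i = square_integrable_of_ext_variance[OF prob_space_axioms cm ivar(1)[folded c_def] this]
  have V: "C / r\<^sup>2 / real n \<le> V / real n" "v * real n / (real n * r)\<^sup>2 \<le> V / real n"
    "w / real n \<le> V / real n" "V / real n \<ge> 0"
    using var(2) uvar(2) ivar(2) r n'
    by (auto simp: V_def power_mult_distrib power2_eq_square add_divide_distrib ac_simps)
  have "expectation c - expectation A = (expectation u - enn2real (quad_risk n \<theta> t)) / (real n * r)"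
    by (simp add: c(2) A(3) diff_divide_distrib)
  then have "\<bar>expectation c - expectation A\<bar> \<le> b * sqrt (real n) / (real n * r)"
    using bias r n' by (simp add: abs_div divide_right_mono abs_mult)
  also have "\<dots> = d"
    unfolding d_def using r n' real_sqrt_mult_self[of "real n"] by (simp add: field_simps)
  finally have cA: "\<bar>expectation c - expectation A\<bar> \<le> d" .
  have d: "d \<le> 1 / 2"
    using large r n' by (simp add: d_def field_simps)
  have "enn2real (quad_risk n \<theta> t) \<le> q * real n"
    using q by (intro enn2real_leI) auto
  then have K: "expectation A \<le> K"
    unfolding A(3) K_def using r n' by (simp add: field_simps)
  note ex = expected_excess_le[OF A(1,2,4) order_trans[OF A(5) V(1)] c(1) u(2)[folded c_def] c(3)
      order_trans[OF c(4) V(2)] i(1,2) order_trans[OF i(3) V(3)] cA d K V(4)]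
  have risk: "pred_risk n r \<theta> (gauss_pde n r t c)
      = ereal (real n / 2 * expectation (\<lambda>x. ln (c x) + A x / c x - 1))"
    unfolding pred_risk_gauss_pde[OF r n u(2)[folded c_def]]
    using ex(1) by (subst ext_integral_eq_integral) (simp_all add: A_def)
  have rho: "rho0 n r \<theta> t = ereal (real n / 2 * expectation (\<lambda>x. ln (A x)))"
    using rho0_approx(1)[OF r n t var] by (simp add: A_def)
  have "real n / 2 * expectation (\<lambda>x. ln (c x) + A x / c x - 1)
      - real n / 2 * expectation (\<lambda>x. ln (A x))
      \<le> real n / 2 * (2 * d\<^sup>2 + 2 * (V / real n) + 2 * K * (V / real n))"
    unfolding right_diff_distrib[symmetric] using ex(2) by (intro mult_left_mono) auto
  \<comment> \<open>The dimension cancels since \<open>n d^2\<close> is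
    \<open>(b / r)^2\<close>.\<close>
  also have "real n / 2 * (2 * d\<^sup>2 + 2 * (V / real n) + 2 * K * (V / real n))
      = (b / r)\<^sup>2 + (1 + K) * V"
    using r n' by (simp add: d_def power_divide field_simps)
  finally have "real n / 2 * expectation (\<lambda>x. ln (c x) + A x / c x - 1)
      - real n / 2 * expectation (\<lambda>x. ln (A x)) \<le> (b / r)\<^sup>2 + (1 + K) * V" .
  moreover have "(b / r)\<^sup>2 + (1 + K) * V = (b / r)\<^sup>2 + (2 + q / r) * ((C + v) / r\<^sup>2 + w)"
    by (simp add: K_def V_def)
  ultimately show ?thesis
    unfolding c_def[symmetric] risk rho by simp
qed

section \<open>Passage from a fixed dimension to the limit\<close>

theorem theorem1p1:
  fixes r :: real and \<theta> :: "nat \<Rightarrow> real" and t :: "nat \<Rightarrow> (nat \<Rightarrow> real) \<Rightarrow> (nat \<Rightarrow> real)"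
  assumes "r > 0" and "t \<in> class_A r"
  shows "(\<exists>C::real. \<forall>\<^sub>F n in sequentially.
            \<bar>rho0 n r \<theta> (t n)
              - ereal (real n / 2 * ln (1 + enn2real (quad_risk n \<theta> (t n)) / (real n * r)))\<bar> \<le> ereal C)
       \<and> (\<forall>U. suitable_risk_estimate r t U \<longrightarrow>
            (\<exists>C::real. \<forall>\<^sub>F n in sequentially.
               pred_risk n r \<theta> (gauss_pde n r (t n) (plugin_scale n r (U n))) - rho0 n r \<theta> (t n)
                 \<le> ereal C))"
proof -
  obtain q C where qC: "q \<ge> 0" "C \<ge> 0"
    "\<forall>\<^sub>F n in sequentially. n > 0 \<and> t n \<in> leb n \<rightarrow>\<^sub>M leb n \<and>
      quad_risk n \<theta> (t n) \<le> ennreal (q * real n) \<and>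
      ext_variance (gauss n \<theta> 1) (\<lambda>x. sqdist n (t n x) \<theta>) \<le> ennreal (C * real n)"
    using class_A_bounds[OF assms(2)] by blast
  have "\<forall>\<^sub>F n in sequentially. \<bar>rho0 n r \<theta> (t n)
      - ereal (real n / 2 * ln (1 + enn2real (quad_risk n \<theta> (t n)) / (real n * r)))\<bar>
      \<le> ereal (C / r\<^sup>2 / 2)"
    using qC(3) by eventually_elim (intro rho0_approx(2), use assms qC in auto)
  moreover have "\<exists>C. \<forall>\<^sub>F n in sequentially.
      pred_risk n r \<theta> (gauss_pde n r (t n) (plugin_scale n r (U n))) - rho0 n r \<theta> (t n) \<le> ereal C"
    if U: "suitable_risk_estimate r t U" for U
  proof -
    obtain b v w where bvw: "b \<ge> 0" "v \<ge> 0" "w \<ge> 0"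
      "\<forall>\<^sub>F n in sequentially. U n \<in> borel_measurable (leb n) \<and>
        (AE x in gauss n \<theta> 1. plugin_scale n r (U n) x > 0) \<and>
        \<bar>(\<integral>x. U n x \<partial>gauss n \<theta> 1) - enn2real (quad_risk n \<theta> (t n))\<bar> \<le> b * sqrt (real n) \<and>
        ext_variance (gauss n \<theta> 1) (U n) \<le> ennreal (v * real n) \<and>
        ext_variance (gauss n \<theta> 1) (\<lambda>x. inverse (plugin_scale n r (U n) x)) \<le> ennreal (w / real n)"
      using suitable_risk_estimate_bounds[OF U] by blast
    have "filterlim (\<lambda>n. sqrt (real n)) at_top sequentially"
      by (rule filterlim_compose[OF sqrt_at_top filterlim_real_sequentially])
    \<comment> \<open>From such \<open>n\<close> on the scaled bias \<open>b / (r sqrt n)\<close> is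
      at most 1/2, so the mean of the plug-in scale is bounded away from 0.\<close>
    then have "\<forall>\<^sub>F n in sequentially. 2 * b / r \<le> sqrt (real n)"
      by (simp add: filterlim_at_top)
    with qC(3) bvw(4) have "\<forall>\<^sub>F n in sequentially.
        pred_risk n r \<theta> (gauss_pde n r (t n) (plugin_scale n r (U n))) - rho0 n r \<theta> (t n)
        \<le> ereal ((b / r)\<^sup>2 + (2 + q / r) * ((C + v) / r\<^sup>2 + w))"
      by eventually_elim (intro plugin_excess_le, use assms qC bvw in auto)
    then show ?thesis by blast
  qed
  ultimately show ?thesis by blast
qed

end
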